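(* Let $\Omega$ be a nonempty possibility space, let $\mathcal{L}$ be the set of all bounded random variables on $\Omega$, let $\mathcal{D}\subseteq\mathcal{L}$ be an arbitrary nonempty set, and let $\underline{P}:\mathcal{D}\to\mathbb{R}$ be a lower prevision with convex natural extension $\underline{E}_c$. Then $\underline{E}_c(Z)$ is finite for every $Z\in\mathcal{L}$ if and only if $\underline{P}$ avoids unbounded sure loss on $\mathcal{D}$.
   Context: A bounded random variable on $\Omega$ is a bounded function $\Omega\to\mathbb{R}$; inequalities between random variables are pointwise, real numbers are identified with constant random variables, and $\sup$ of a random variable is its supremum over $\Omega$. A lower prevision on $\mathcal{D}$ is any real-valued function $\underline{P}:\mathcal{D}\to\mathbb{R}$; no structure is assumed on $\mathcal{D}$. Convex natural extension: for $Z\in\mathcal{L}$ let $L(Z)$ be the set of all $\alpha\in\mathbb{R}$ such that $Z-\alpha\ge\sum_{i=1}^n s_i\,(X_i-\underline{P}(X_i))$ for some integer $n\ge 1$, some $X_1,\dots,X_n\in\mathcal{D}$ and some real $s_1,\dots,s_n\ge 0$ with $\sum_{i=1}^n s_i=1$. The convex natural extension of $\underline{P}$ on $Z$ is $\underline{E}_c(Z)=\sup L(Z)$, taken in the extended real line. Avoiding unbounded sure loss: $\underline{P}$ avoids unbounded sure loss on $\mathcal{D}$ iff there exists $k\in\mathbb{R}$ such that, for all integers $n\ge 1$, all $X_1,\dots,X_n\in\mathcal{D}$ and all real $s_1,\dots,s_n\ge 0$ with $\sum_{i=1}^n s_i=1$, one has $\sup\sum_{i=1}^n s_i\,(X_i-\underline{P}(X_i))\ge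 k$. *)

theory Defs
  imports "HOL-Analysis.Analysis"
begin

(* The possibility space is the type 'w, nonempty like every type.
   A lower prevision on D is a total function P of which only the values on D are used. *)

definition bounded_rvs :: "('w \<Rightarrow> real) set" where
  "bounded_rvs = {X. bounded (range X)}"

definition supporting_set ::
  "('w \<Rightarrow> real) set \<Rightarrow> (('w \<Rightarrow> real) \<Rightarrow> real) \<Rightarrow> ('w \<Rightarrow> real) \<Rightarrow> real set" where
  "supporting_set D P Z =
    {\<alpha>. \<exists>(n::nat) (X :: nat \<Rightarrow> 'w \<Rightarrow> real) (s :: nat \<Rightarrow> real).
        n \<ge> 1 \<and> (\<forall>i\<in>{1..n}. X i \<in> D) \<and> (\<forall>i\<in>{1..n}. s i \<ge> 0) \<and> (\<Sum>i=1..n. s i) = 1 \<and>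
        (\<forall>\<omega>. Z \<omega> - \<alpha> \<ge> (\<Sum>i=1..n. s i * (X i \<omega> - P (X i))))}"

definition convex_natural_extension ::
  "('w \<Rightarrow> real) set \<Rightarrow> (('w \<Rightarrow> real) \<Rightarrow> real) \<Rightarrow> ('w \<Rightarrow> real) \<Rightarrow> ereal" where
  "convex_natural_extension D P Z = Sup (ereal ` supporting_set D P Z)"

(* The supremum is taken in the reals; it is the true one as soon as D consists of bounded
   random variables, since the sum is then bounded above and 'w is nonempty. *)

definition avoids_unbounded_sure_loss ::
  "('w \<Rightarrow> real) set \<Rightarrow> (('w \<Rightarrow> real) \<Rightarrow> real) \<Rightarrow> bool" where
  "avoids_unbounded_sure_loss D P \<longleftrightarrow>
    (\<exists>k::real. \<forall>(n::nat) (X :: nat \<Rightarrow> 'w \<Rightarrow> real) (s :: nat \<Rightarrow> real).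
        n \<ge> 1 \<and> (\<forall>i\<in>{1..n}. X i \<in> D) \<and> (\<forall>i\<in>{1..n}. s i \<ge> 0) \<and> (\<Sum>i=1..n. s i) = 1 \<longrightarrow>
        (SUP \<omega>. \<Sum>i=1..n. s i * (X i \<omega> - P (X i))) \<ge> k)"

end

theory Submission
  imports Defs
begin

text \<open>
  If a gain \<open>g\<close> satisfies \<open>g \<le> Z - \<alpha>\<close> and \<open>Z \<le> B\<close>, then \<open>\<alpha> \<le> B - sup g\<close>, so a lower bound on
  the suprema of all gains bounds the convex natural extension from above. Conversely, \<open>- sup g\<close>
  supports \<open>Z = 0\<close>, so finiteness at the single point \<open>0\<close> already bounds all \<open>sup g\<close> from below.
\<close>

text \<open>The data \<open>n\<close>, \<open>X\<close>, \<open>s\<close> occur in the same way in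
  the supporting set and in the sure loss condition. Collecting the resulting functions in one set
  leaves a single variable \<open>g\<close> to quantify over in both.\<close>

definition convex_gains ::
  "('w \<Rightarrow> real) set \<Rightarrow> (('w \<Rightarrow> real) \<Rightarrow> real) \<Rightarrow> ('w \<Rightarrow> real) set" where
  "convex_gains D P =
    {g. \<exists>(n::nat) (X :: nat \<Rightarrow> 'w \<Rightarrow> real) (s :: nat \<Rightarrow> real).
        n \<ge> 1 \<and> (\<forall>i\<in>{1..n}. X i \<in> D) \<and> (\<forall>i\<in>{1..n}. s i \<ge> 0) \<and> (\<Sum>i=1..n. s i) = 1 \<and>
        g = (\<lambda>\<omega>. \<Sum>i=1..n. s i * (X i \<omega> - P (X i)))}"

lemma supporting_set_iff:
  "\<alpha> \<in> supporting_set D P Z \<longleftrightarrow> (\<exists>g\<in>convex_gains D P. \<forall>\<omega>. g \<omega> \<le> Z \<omega> - \<alpha>)"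
  (is "?L \<longleftrightarrow> ?R")
proof
  assume ?L
  then obtain n :: nat and X s where *:
      "n \<ge> 1" "\<forall>i\<in>{1..n}. X i \<in> D" "\<forall>i\<in>{1..n}. s i \<ge> 0" "(\<Sum>i=1..n. s i) = 1"
    and le: "\<forall>\<omega>. Z \<omega> - \<alpha> \<ge> (\<Sum>i=1..n. s i * (X i \<omega> - P (X i)))"
    unfolding supporting_set_def by blast
  from * have "(\<lambda>\<omega>. \<Sum>i=1..n. s i * (X i \<omega> - P (X i))) \<in> convex_gains D P"
    unfolding convex_gains_def by blast
  \<comment> \<open>The rotation puts the membership premise first, so the chained fact fixes the
    witness before \<open>le\<close> is matched against the inequality.\<close>
  then show ?R
    by (rule bexI[rotated]) (rule le)
next
  assume ?R
  then show ?L
    unfolding supporting_set_def convex_gains_def by blast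
qed

lemma avoids_unbounded_sure_loss_iff:
  "avoids_unbounded_sure_loss D P \<longleftrightarrow> (\<exists>k. \<forall>g\<in>convex_gains D P. k \<le> (SUP \<omega>. g \<omega>))"
  unfolding avoids_unbounded_sure_loss_def convex_gains_def by blast

lemma convex_gains_nonempty:
  assumes "D \<noteq> {}"
  shows "convex_gains D P \<noteq> {}"
proof -
  obtain Y where "Y \<in> D"
    using assms by blast
  then have "(\<lambda>\<omega>. \<Sum>i=1..1::nat. 1 * (Y \<omega> - P Y)) \<in> convex_gains D P"
    unfolding convex_gains_def
    by (intro CollectI exI[of _ "1::nat"] exI[of _ "\<lambda>_. Y"] exI[of _ "\<lambda>_. 1"]) simp
  then show ?thesis
    by blast
qed

lemma bounded_rvs_iff: "X \<in> bounded_rvs \<longleftrightarrow> (\<exists>B. \<forall>\<omega>. \<bar>X \<omega>\<bar> \<le> B)"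
  by (auto simp: bounded_rvs_def bounded_iff)

lemma bounded_rvs_sum:
  assumes "\<And>i. i \<in> I \<Longrightarrow> f i \<in> bounded_rvs"
  shows "(\<lambda>\<omega>. \<Sum>i\<in>I. f i \<omega>) \<in> bounded_rvs"
proof -
  have "\<forall>i\<in>I. \<exists>B. \<forall>\<omega>. \<bar>f i \<omega>\<bar> \<le> B"
    using assms by (simp add: bounded_rvs_iff)
  then obtain B where "\<forall>i\<in>I. \<forall>\<omega>. \<bar>f i \<omega>\<bar> \<le> B i"
    by metis
  then have "\<bar>\<Sum>i\<in>I. f i \<omega>\<bar> \<le> (\<Sum>i\<in>I. B i)" for \<omega>
    by (intro order_trans[OF sum_abs] sum_mono) simp
  then show ?thesis
    by (auto simp: bounded_rvs_iff)
qed

text \<open>This is the shape of a single summand of a gain, with \<open>a\<close> a weight and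
  \<open>c\<close> the value of \<open>P\<close> at \<open>X\<close>.\<close>

lemma bounded_rvs_affine:
  assumes "X \<in> bounded_rvs"
  shows "(\<lambda>\<omega>. a * (X \<omega> - c)) \<in> bounded_rvs"
proof -
  obtain B where B: "\<bar>X \<omega>\<bar> \<le> B" for \<omega>
    using assms by (auto simp: bounded_rvs_iff)
  have "\<bar>a * (X \<omega> - c)\<bar> \<le> \<bar>a\<bar> * (B + \<bar>c\<bar>)" for \<omega>
    unfolding abs_mult using B[of \<omega>] by (intro mult_left_mono) auto
  then show ?thesis
    by (auto simp: bounded_rvs_iff)
qed

lemma convex_gains_bounded:
  assumes "D \<subseteq> bounded_rvs"
  shows "convex_gains D P \<subseteq> bounded_rvs"
  using assms unfolding convex_gains_def
  by (auto intro!: bounded_rvs_sum bounded_rvs_affine)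

text \<open>The supremum is that of the reals, so it is known to dominate the values of
  \<open>g\<close> only once these are bounded above.\<close>

lemma bounded_rvs_le_SUP:
  assumes "g \<in> bounded_rvs"
  shows "g \<omega> \<le> (SUP \<omega>. g \<omega>)"
  using assms by (intro cSUP_upper) (auto simp: bounded_rvs_def dest: bounded_imp_bdd_above)

text \<open>Any gain lies below any bounded \<open>Z\<close> after a large enough constant shift.
  This keeps the convex natural extension away from minus infinity.\<close>

lemma supporting_set_nonempty:
  assumes "D \<subseteq> bounded_rvs" "D \<noteq> {}" "Z \<in> bounded_rvs"
  shows "supporting_set D P Z \<noteq> {}"
proof -
  obtain g where g: "g \<in> convex_gains D P"
    using convex_gains_nonempty[OF assms(2)] by blast
  then have "g \<in> bounded_rvs"
    using convex_gains_bounded[OF assms(1)] by blast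
  then obtain C B where "\<And>\<omega>. \<bar>g \<omega>\<bar> \<le> C" "\<And>\<omega>. \<bar>Z \<omega>\<bar> \<le> B"
    using assms(3) by (auto simp: bounded_rvs_iff)
  \<comment> \<open>The shift comes from the worst case: g \<le> C = - B + (B + C) \<le> Z + (B +
    C).\<close>
  then have "g \<omega> \<le> Z \<omega> - (- B - C)" for \<omega>
    by (smt (verit))
  with g have "- B - C \<in> supporting_set D P Z"
    by (auto simp: supporting_set_iff)
  then show ?thesis
    by blast
qed

text \<open>An element of the supporting set bounds its extended supremum below by a real, so the
  only way to be infinite is to be plus infinity, that is, to have no real upper bound.\<close>

lemma convex_natural_extension_finite_iff:
  assumes "D \<subseteq> bounded_rvs" "D \<noteq> {}" "Z \<in> bounded_rvs"
  shows "\<bar>convex_natural_extension D P Z\<bar> \<noteq> \<infinity> \<longleftrightarrow> bdd_above (supporting_set D P Z)"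
proof
  assume "\<bar>convex_natural_extension D P Z\<bar> \<noteq> \<infinity>"
  then obtain r where r: "Sup (ereal ` supporting_set D P Z) = ereal r"
    by (auto simp: convex_natural_extension_def)
  have "\<alpha> \<le> r" if "\<alpha> \<in> supporting_set D P Z" for \<alpha>
    using Sup_upper[OF imageI[OF that, of ereal]] r by simp
  then show "bdd_above (supporting_set D P Z)"
    by (rule bdd_aboveI)
next
  assume "bdd_above (supporting_set D P Z)"
  then obtain M where "\<And>\<alpha>. \<alpha> \<in> supporting_set D P Z \<Longrightarrow> \<alpha> \<le> M"
    by (auto simp: bdd_above_def)
  then have upper: "convex_natural_extension D P Z \<le> ereal M"
    unfolding convex_natural_extension_def by (intro Sup_least) auto
  obtain \<alpha> where "\<alpha> \<in> supporting_set D P Z"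
    using supporting_set_nonempty[OF assms] by blast
  then have "ereal \<alpha> \<le> convex_natural_extension D P Z"
    unfolding convex_natural_extension_def by (intro Sup_upper) auto
  with upper show "\<bar>convex_natural_extension D P Z\<bar> \<noteq> \<infinity>"
    by auto
qed

theorem proposition3:
  fixes D :: "('w \<Rightarrow> real) set" and P :: "('w \<Rightarrow> real) \<Rightarrow> real"
  assumes "D \<subseteq> bounded_rvs" and "D \<noteq> {}"
  shows "(\<forall>Z\<in>bounded_rvs. \<bar>convex_natural_extension D P Z\<bar> \<noteq> \<infinity>)
    \<longleftrightarrow> avoids_unbounded_sure_loss D P"
proof
  assume finite: "\<forall>Z\<in>bounded_rvs. \<bar>convex_natural_extension D P Z\<bar> \<noteq> \<infinity>"
  have zero: "(\<lambda>_. 0) \<in> (bounded_rvs :: ('w \<Rightarrow> real) set)"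
    by (auto simp: bounded_rvs_iff)
  have "bdd_above (supporting_set D P (\<lambda>_. 0))"
    using bspec[OF finite zero] by (rule convex_natural_extension_finite_iff[OF assms zero, THEN iffD1])
  then obtain M where M: "\<And>\<alpha>. \<alpha> \<in> supporting_set D P (\<lambda>_. 0) \<Longrightarrow> \<alpha> \<le> M"
    by (auto simp: bdd_above_def)
  \<comment> \<open>\<open>M\<close> was obtained before \<open>g\<close> is fixed, so - M serves as
    one constant \<open>k\<close> for all gains.\<close>
  have "- M \<le> (SUP \<omega>. g \<omega>)" if g: "g \<in> convex_gains D P" for g
  proof -
    have "g \<in> bounded_rvs"
      using g convex_gains_bounded[OF assms(1)] by blast
    then have "- (SUP \<omega>. g \<omega>) \<in> supporting_set D P (\<lambda>_. 0)"
      unfolding supporting_set_iff by (intro bexI[OF _ g]) (simp add: bounded_rvs_le_SUP)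
    then show ?thesis
      using M by fastforce
  qed
  then show "avoids_unbounded_sure_loss D P"
    by (auto simp: avoids_unbounded_sure_loss_iff)
next
  assume "avoids_unbounded_sure_loss D P"
  then obtain k where k: "\<And>g. g \<in> convex_gains D P \<Longrightarrow> k \<le> (SUP \<omega>. g \<omega>)"
    by (auto simp: avoids_unbounded_sure_loss_iff)
  show "\<forall>Z\<in>bounded_rvs. \<bar>convex_natural_extension D P Z\<bar> \<noteq> \<infinity>"
  proof
    fix Z :: "'w \<Rightarrow> real"
    assume Z: "Z \<in> bounded_rvs"
    then obtain B where B: "\<And>\<omega>. \<bar>Z \<omega>\<bar> \<le> B"
      by (auto simp: bounded_rvs_iff)
    have "\<alpha> \<le> B - k" if \<alpha>: "\<alpha> \<in> supporting_set D P Z" for \<alpha>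
    proof -
      obtain g where g: "g \<in> convex_gains D P" and le: "\<And>\<omega>. g \<omega> \<le> Z \<omega> - \<alpha>"
        using \<alpha> by (auto simp: supporting_set_iff)
      have "g \<omega> \<le> B - \<alpha>" for \<omega>
        using le[of \<omega>] B[of \<omega>] by linarith
      \<comment> \<open>A real supremum is below a common upper bound when the index set is
        nonempty; here it is the whole type, hence nonempty.\<close>
      then have "(SUP \<omega>. g \<omega>) \<le> B - \<alpha>"
        by (intro cSUP_least) auto
      with k[OF g] show ?thesis
        by linarith
    qed
    then have "bdd_above (supporting_set D P Z)"
      by (rule bdd_aboveI)
    then show "\<bar>convex_natural_extension D P Z\<bar> \<noteq> \<infinity>"
      by (rule convex_natural_extension_finite_iff[OF assms Z, THEN iffD2])
  qed
qed

end
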